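(* Let $m\in\mathbb{Z}^+$ be fixed, let $(\tilde G_m^t)_{t\ge1}$ be the random graph process defining the II-PA model, and for $k\ge1$ let $\vec N_{k,t}^{\mathrm{II\text{-}PA}}$ be the number of vertices with in-degree equal to $k$ at time $t$ in $(\tilde G_m^t)_{t\ge1}$. Then, for every $k\ge1$, at times $t=n(m+1)$, $$\frac{\vec N_{k,t}^{\mathrm{II\text{-}PA}}}{n}\longrightarrow\frac{(1+1/m)\,\Gamma(k)\,\Gamma(2+1/m)}{\Gamma(k+2+1/m)}$$ almost surely as $n\to\infty$.
   Context: II-PA model with parameter $m\in\mathbb{Z}^+$: $(\tilde G_m^t)_{t\ge1}$ is a random directed (multi)graph process in discrete time, starting from the empty graph at time $0$, such that for every integer $n\ge0$: (a) at time $t=n(m+1)+1$ a new vertex $v_{n+1}$ is added together with one directed loop (which counts one for its in-degree); (b) for $i=2,\dots,m+1$, at time $t=n(m+1)+i$ a directed edge is added from $v_{n+1}$ to a random vertex $v_j$, $1\le j\le n+1$, chosen, conditionally on the past, with probability $\vec d(v_j,t-1)/(t-1)$. Here $\vec d(v,t)$ denotes the in-degree of $v$ at time $t$, i.e. the number of incoming edges, where every directed loop counts one. At time $t=n(m+1)$ there are exactly $n$ vertices. $\Gamma$ is the Gamma function. *)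

theory Defs
  imports "HOL-Probability.Probability" "Graph_Theory.Digraph"
begin

text \<open>
  An arc is a triple (time of insertion, tail, head); the time stamp keeps parallel arcs apart.
  The vertex $v_j$ is the natural number $j$, for $j \ge 1$.
\<close>

type_synonym arc = "nat \<times> nat \<times> nat"

type_synonym multidigraph = "(nat, arc) pre_digraph"

definition empty_graph :: multidigraph where
  "empty_graph = \<lparr>verts = {}, arcs = {}, tail = (\<lambda>(s, u, v). u), head = (\<lambda>(s, u, v). v)\<rparr>"

definition in_degree_count :: "nat \<Rightarrow> ('v, 'e) pre_digraph \<Rightarrow> nat" where
  "in_degree_count k H = card {v \<in> verts H. in_degree H v = k}"

text \<open>
  The process is an arbitrary one with the prescribed transition law, on an arbitrary
  probability space.  As every \<open>G t\<close> takes almost surely only finitely many values, the past up to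
  time \<open>t - 1\<close> is conditioned on by fixing a history \<open>g 0, \<dots>, g (t - 1)\<close> of positive
  probability.  That the graph at time \<open>t\<close> arises from the one at time \<open>t - 1\<close> by adding one of the
  \<open>n + 1\<close> possible arcs is part of \<open>attach\<close>: the probabilities given there sum up to one, since the
  in-degrees at time \<open>t - 1\<close> sum up to \<open>t - 1\<close>.
\<close>

locale II_PA = prob_space M for M :: "'a measure" +
  fixes m :: nat and G :: "nat \<Rightarrow> 'a \<Rightarrow> multidigraph"
  assumes random_graph: "\<And>t. G t \<in> M \<rightarrow>\<^sub>M count_space UNIV"
    and start: "AE \<omega> in M. G 0 \<omega> = empty_graph"
    and new_vertex: "\<And>n t. t = n * (m + 1) + 1 \<Longrightarrow>
      AE \<omega> in M. G t \<omega> =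
        pre_digraph.add_arc (pre_digraph.add_vert (G (t - 1) \<omega>) (n + 1)) (t, n + 1, n + 1)"
    and attach: "\<And>n i t j g. i \<in> {2..m + 1} \<Longrightarrow> t = n * (m + 1) + i \<Longrightarrow> j \<in> {1..n + 1} \<Longrightarrow>
      \<P>(\<omega> in M. \<forall>s<t. G s \<omega> = g s) > 0 \<Longrightarrow>
      \<P>(\<omega> in M. G t \<omega> = pre_digraph.add_arc (G (t - 1) \<omega>) (t, n + 1, j) \<bar> \<forall>s<t. G s \<omega> = g s)
        = real (in_degree (g (t - 1)) j) / real (t - 1)"

end

theory Submission
  imports Defs
begin

text \<open>
  Let \<open>N k t\<close> be the number of vertices of in-degree \<open>k\<close> at time \<open>t\<close>.  At a step that adds a random arc,
  the conditional mean of its increment is \<open>((k - 1) N (k - 1) - k N k) / (t - 1)\<close>.  A function of \<open>t\<close>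
  that is linear, with the slope claimed, up to a term periodic with period \<open>m + 1\<close> satisfies this
  recursion up to \<open>O(1/t)\<close>.  For the deviation \<open>D k\<close> of \<open>N k\<close> from it, expanding the square gives
  \<open>E (D k (s + 1))\<^sup>2 \<le> E (D k s)\<^sup>2 + (k - 1) / s * E (D (k - 1) s)\<^sup>2 + O(1)\<close>, so by induction
  on \<open>k\<close> the second moments grow at most linearly.  Hence \<open>D k t / t\<close> tends to 0 almost surely along
  the squares, and along all \<open>t\<close> because an arc changes \<open>N k\<close> by at most one.
\<close>

subsection \<open>Sequences with linearly growing second moments\<close>

text \<open>With \<open>q t\<close> the integer square root, \<open>t\<close> exceeds
  \<open>(q t)^2\<close> by at most \<open>2 * q t\<close>, so bounded increments move
  \<open>y\<close> by at most \<open>2 * L * q t\<close> from its value at that square. After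
  division by \<open>t >= (q t)^2\<close> the error is at most \<open>2 * L / q t\<close>, which
  vanishes.\<close>

lemma interpolate_squares:
  fixes y :: "nat \<Rightarrow> real"
  assumes lim: "(\<lambda>j. y (j\<^sup>2) / real (j\<^sup>2)) \<longlonglongrightarrow> 0"
    and incr: "\<And>t. \<bar>y (Suc t) - y t\<bar> \<le> L"
  shows "(\<lambda>t. y t / real t) \<longlonglongrightarrow> 0"
proof -
  define q :: "nat \<Rightarrow> nat" where "q t = nat \<lfloor>sqrt (real t)\<rfloor>" for t
  have L: "L \<ge> 0" using incr[of 0] by linarith
  have dist: "\<bar>y (a + d) - y a\<bar> \<le> L * real d" for a d
  proof (induction d)
    case (Suc d)
    then show ?case using incr[of "a + d"] by (simp add: algebra_simps)
  qed simp
  have q_le: "(q t)\<^sup>2 \<le> t" for t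
  proof -
    have "real (q t) \<le> sqrt (real t)" by (simp add: q_def)
    then have "(real (q t))\<^sup>2 \<le> (sqrt (real t))\<^sup>2" by (intro power_mono) auto
    then show ?thesis by (simp flip: of_nat_power)
  qed
  have q_ge: "t \<le> (q t)\<^sup>2 + 2 * q t" for t
  proof -
    have "sqrt (real t) < real (q t) + 1" by (simp add: q_def)
    then have "(sqrt (real t))\<^sup>2 < (real (q t) + 1)\<^sup>2" by (intro power_strict_mono) auto
    then have "real t < real ((q t + 1)\<^sup>2)" by (simp add: add.commute)
    then have "t < (q t + 1)\<^sup>2" by linarith
    then show ?thesis by (simp add: power2_eq_square)
  qed
  have q_lim: "filterlim q at_top sequentially"
  proof -
    have "filterlim (\<lambda>t::nat. sqrt (real t)) at_top sequentially"
      by (intro filterlim_compose[OF sqrt_at_top filterlim_real_sequentially])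
    then have "filterlim (\<lambda>t::nat. \<lfloor>sqrt (real t)\<rfloor>) at_top sequentially"
      by (rule filterlim_compose[OF filterlim_floor_sequentially])
    then show ?thesis
      unfolding q_def by (rule filterlim_compose[OF filterlim_nat_sequentially])
  qed
  have "(\<lambda>t. \<bar>y ((q t)\<^sup>2) / real ((q t)\<^sup>2)\<bar> + 2 * L / real (q t)) \<longlonglongrightarrow> 0"
  proof -
    have "(\<lambda>j. \<bar>y (j\<^sup>2) / real (j\<^sup>2)\<bar> + 2 * L / real j) \<longlonglongrightarrow> \<bar>0\<bar> + 0"
      by (intro tendsto_add tendsto_rabs lim lim_const_over_n)
    from filterlim_compose[OF this q_lim] show ?thesis by simp
  qed
  then show ?thesis
  proof (rule Lim_null_comparison[rotated])
    have "\<forall>\<^sub>F t in sequentially. q t \<ge> 1"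
      using q_lim by (simp add: filterlim_at_top)
    then show "\<forall>\<^sub>F t in sequentially. norm (y t / real t)
      \<le> \<bar>y ((q t)\<^sup>2) / real ((q t)\<^sup>2)\<bar> + 2 * L / real (q t)"
    proof eventually_elim
      case (elim t)
      let ?q = "real (q t)"
      have q0: "?q > 0" using elim by simp
      have q2: "?q\<^sup>2 \<le> real t" using q_le[of t] by (metis of_nat_le_iff of_nat_power)
      have q2_pos: "0 < ?q\<^sup>2" using q0 by simp
      have "\<bar>y t\<bar> \<le> \<bar>y ((q t)\<^sup>2)\<bar> + L * real (t - (q t)\<^sup>2)"
        using dist[of "(q t)\<^sup>2" "t - (q t)\<^sup>2"] q_le[of t] by simp
      also have "\<dots> \<le> \<bar>y ((q t)\<^sup>2)\<bar> + L * (2 * ?q)"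
      proof -
        have "real (t - (q t)\<^sup>2) \<le> real (2 * q t)" using q_ge[of t] by (intro of_nat_mono) linarith
        then show ?thesis using L by (intro add_left_mono mult_left_mono) auto
      qed
      finally have "\<bar>y t\<bar> / real t \<le> (\<bar>y ((q t)\<^sup>2)\<bar> + L * (2 * ?q)) / real t"
        by (rule divide_right_mono) simp
      also have "\<dots> \<le> (\<bar>y ((q t)\<^sup>2)\<bar> + L * (2 * ?q)) / ?q\<^sup>2"
        using L by (intro divide_left_mono q2 mult_pos_pos less_le_trans[OF q2_pos q2] q2_pos
            add_nonneg_nonneg mult_nonneg_nonneg) auto
      also have "\<dots> = \<bar>y ((q t)\<^sup>2) / real ((q t)\<^sup>2)\<bar> + 2 * L / ?q"
        using q0 by (simp add: add_divide_distrib power2_eq_square)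
      finally show ?case by simp
    qed
  qed
qed

text \<open>Along the squares the second moments of the quotients are at most
  \<open>2 * C / j^2\<close>, hence summable; so the series of squared quotients is almost surely
  finite and its terms tend to 0. Along all \<open>t\<close> the same bound is only of order
  \<open>1 / t\<close>, so bounded increments have to fill the gaps between squares.\<close>

lemma (in prob_space) AE_tendsto_zero_if_second_moment_linear:
  fixes Y :: "nat \<Rightarrow> 'a \<Rightarrow> real"
  assumes meas [measurable]: "\<And>t. random_variable borel (Y t)"
    and int: "\<And>t. integrable M (\<lambda>\<omega>. (Y t \<omega>)\<^sup>2)"
    and mom: "\<And>t. expectation (\<lambda>\<omega>. (Y t \<omega>)\<^sup>2) \<le> C * (real t + 1)"
    and incr: "AE \<omega> in M. \<forall>t. \<bar>Y (Suc t) \<omega> - Y t \<omega>\<bar> \<le> L"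
  shows "AE \<omega> in M. (\<lambda>t. Y t \<omega> / real t) \<longlonglongrightarrow> 0"
proof -
  define Z where "Z j \<omega> = (Y (j\<^sup>2) \<omega> / real (j\<^sup>2))\<^sup>2" for j \<omega>
  have Z_meas [measurable]: "random_variable borel (Z j)" for j unfolding Z_def by measurable
  have C: "C \<ge> 0"
  proof -
    have "0 \<le> expectation (\<lambda>\<omega>. (Y 0 \<omega>)\<^sup>2)" by simp
    also note mom[of 0]
    finally show ?thesis by simp
  qed
  have Z_int: "integrable M (Z j)" for j
    unfolding Z_def power_divide by (intro integrable_divide_zero int)
  have Z_le: "expectation (Z j) \<le> 2 * C * inverse ((real j)\<^sup>2)" for j
  proof (cases "j = 0")
    case False
    then have j: "(real j)\<^sup>2 \<ge> 1" by simp
    have "expectation (Z j) = expectation (\<lambda>\<omega>. (Y (j\<^sup>2) \<omega>)\<^sup>2) / ((real j)\<^sup>2)\<^sup>2"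
      unfolding Z_def by (simp add: power_divide)
    also have "\<dots> \<le> C * (real (j\<^sup>2) + 1) / ((real j)\<^sup>2)\<^sup>2"
      by (intro divide_right_mono mom) simp
    also have "\<dots> \<le> C * (2 * (real j)\<^sup>2) / ((real j)\<^sup>2)\<^sup>2"
      using C j by (intro divide_right_mono mult_left_mono) auto
    also have "\<dots> = 2 * C * inverse ((real j)\<^sup>2)"
      using False by (simp add: field_simps power2_eq_square)
    finally show ?thesis .
  next
    \<comment> \<open>At \<open>j = 0\<close> division by zero makes both sides 0.\<close>
    case True
    then have "Z j = (\<lambda>\<omega>. 0)" by (simp add: Z_def fun_eq_iff)
    then show ?thesis using True by simp
  qed
  have Z_nn: "expectation (Z j) \<ge> 0" for j by (simp add: Z_def)
  have summ: "summable (\<lambda>j. expectation (Z j))"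
  proof (rule summable_comparison_test')
    show "summable (\<lambda>j. 2 * C * inverse ((real j)\<^sup>2))"
      by (intro summable_mult inverse_power_summable) simp
    show "norm (expectation (Z j)) \<le> 2 * C * inverse ((real j)\<^sup>2)" if "j \<ge> 0" for j
    proof -
      show ?thesis using Z_nn[of j] Z_le[of j] by simp
    qed
  qed
  \<comment> \<open>Sum and integral are exchanged in the extended nonnegative reals, where
    pointwise summability need not be known beforehand.\<close>
  have "(\<integral>\<^sup>+ \<omega>. (\<Sum>j. ennreal (Z j \<omega>)) \<partial>M) = (\<Sum>j. \<integral>\<^sup>+ \<omega>. ennreal (Z j \<omega>) \<partial>M)"
    by (rule nn_integral_suminf) simp
  also have "\<dots> = (\<Sum>j. ennreal (expectation (Z j)))"
    by (intro suminf_cong nn_integral_eq_integral Z_int) (simp add: Z_def)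
  also have "\<dots> \<noteq> \<infinity>"
    using ennreal_suminf_neq_top[OF summ Z_nn] by simp
  finally have fin: "AE \<omega> in M. (\<Sum>j. ennreal (Z j \<omega>)) \<noteq> \<infinity>"
    by (intro nn_integral_PInf_AE) auto
  show ?thesis
    using fin incr
  proof eventually_elim
    case (elim \<omega>)
    have "summable (\<lambda>j. Z j \<omega>)"
      using elim(1) by (intro summable_suminf_not_top) (auto simp: Z_def)
    then have "(\<lambda>j. Z j \<omega>) \<longlonglongrightarrow> 0" by (rule summable_LIMSEQ_zero)
    then have "(\<lambda>j. Y (j\<^sup>2) \<omega> / real (j\<^sup>2)) \<longlonglongrightarrow> 0"
      unfolding Z_def using tendsto_real_sqrt[of "\<lambda>j. (Y (j\<^sup>2) \<omega> / real (j\<^sup>2))\<^sup>2" 0] by (simp add: tendsto_rabs_zero_iff)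
    then show ?case
      using elim(2) by (intro interpolate_squares[of "\<lambda>t. Y t \<omega>"]) auto
  qed
qed

text \<open>Up to a null set \<open>f\<close> is the simple function with value \<open>c i\<close>
  on the event \<open>P i\<close>. As the graph at a fixed time takes almost surely only finitely
  many values, this turns expectations of functions of the graph into finite sums.\<close>

lemma (in prob_space) expectation_finite_partition:
  fixes f :: "'a \<Rightarrow> real"
  assumes fin: "finite I"
    and ev: "\<And>i. i \<in> I \<Longrightarrow> {\<omega> \<in> space M. P i \<omega>} \<in> events"
    and part: "AE \<omega> in M. \<exists>!i. i \<in> I \<and> P i \<omega>"
    and val: "AE \<omega> in M. \<forall>i\<in>I. P i \<omega> \<longrightarrow> f \<omega> = c i"
    and meas: "random_variable borel f"
  shows "integrable M f" "expectation f = (\<Sum>i\<in>I. c i * \<P>(\<omega> in M. P i \<omega>))"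
proof -
  define B where "B i = {\<omega> \<in> space M. P i \<omega>}" for i
  define h where "h = (\<lambda>\<omega>. \<Sum>i\<in>I. c i * indicator (B i) \<omega>)"
  have eq: "AE \<omega> in M. f \<omega> = h \<omega>"
    using part val AE_space
  proof eventually_elim
    case (elim \<omega>)
    from elim(1) obtain i where i: "i \<in> I" "P i \<omega>" "\<And>j. j \<in> I \<Longrightarrow> P j \<omega> \<Longrightarrow> j = i" by blast
    have "h \<omega> = (\<Sum>j\<in>I. if j = i then c i else 0)"
      unfolding h_def
    proof (rule sum.cong[OF refl])
      fix j assume "j \<in> I"
      then have "\<omega> \<in> B j \<longleftrightarrow> j = i" using i(1,2) i(3)[of j] elim(3) unfolding B_def by blast
      then show "c j * indicator (B j) \<omega> = (if j = i then c i else 0)" by (cases "j = i") auto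
    qed
    also have "\<dots> = c i" using i(1) fin by simp
    finally show ?case using elim(2) i(1,2) by simp
  qed
  have ind: "integrable M (\<lambda>\<omega>. c i * indicator (B i) \<omega>)" if "i \<in> I" for i
  proof (rule integrable_mult_right, rule integrable_real_indicator)
    show "B i \<in> events" unfolding B_def by (rule ev[OF that])
    show "emeasure M (B i) < \<infinity>" by (simp add: emeasure_eq_measure)
  qed
  have hi: "integrable M h"
    unfolding h_def using ind by (rule Bochner_Integration.integrable_sum)
  have hm: "random_variable borel h" using hi by (rule borel_measurable_integrable)
  show "integrable M f" using integrable_cong_AE[OF meas hm eq] hi by simp
  have "expectation f = expectation h" by (rule integral_cong_AE[OF meas hm eq])
  also have "\<dots> = (\<Sum>i\<in>I. expectation (\<lambda>\<omega>. c i * indicator (B i) \<omega>))"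
    unfolding h_def using ind by (rule Bochner_Integration.integral_sum)
  also have "\<dots> = (\<Sum>i\<in>I. c i * prob (B i))"
  proof (rule sum.cong[OF refl])
    fix i assume "i \<in> I"
    then have "B i \<inter> space M = B i" using ev by (auto simp: B_def)
    then show "expectation (\<lambda>\<omega>. c i * indicator (B i) \<omega>) = c i * prob (B i)" by simp
  qed
  finally show "expectation f = (\<Sum>i\<in>I. c i * \<P>(\<omega> in M. P i \<omega>))" unfolding B_def .
qed

subsection \<open>The attainable graphs\<close>

text \<open>A finite set containing almost all values of the graph at time \<open>t\<close>, in
  general larger than the set of attainable graphs. Fixing \<open>tail\<close> and
  \<open>head\<close> leaves only the arc set free, whence finiteness; time stamps up to
  \<open>t\<close> make the next arc new; the number of arcs gives the sum of the in-degrees. A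
  round of \<open>m + 1\<close> steps starts with its vertex, so the number of vertices is
  \<open>t / (m + 1)\<close> rounded up.\<close>

definition pa_graphs :: "nat \<Rightarrow> nat \<Rightarrow> multidigraph set" where
  "pa_graphs m t = {g. verts g = {1..(t + m) div (m + 1)}
     \<and> tail g = (\<lambda>(s, u, v). u) \<and> head g = (\<lambda>(s, u, v). v)
     \<and> arcs g \<subseteq> {1..t} \<times> verts g \<times> verts g \<and> card (arcs g) = t}"

text \<open>Here \<open>s\<close> is the time before the step. The step to \<open>Suc s\<close> adds
  a random arc if \<open>s mod (m + 1) \<noteq> 0\<close>, and a vertex with its loop otherwise; in
  both cases \<open>s div (m + 1) + 1\<close> is the vertex of the current round.\<close>

definition attach_arc :: "nat \<Rightarrow> nat \<Rightarrow> multidigraph \<Rightarrow> nat \<Rightarrow> multidigraph" where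
  "attach_arc m s g j = pre_digraph.add_arc g (Suc s, s div (m + 1) + 1, j)"

definition add_loop :: "nat \<Rightarrow> nat \<Rightarrow> multidigraph \<Rightarrow> multidigraph" where
  "add_loop m s g = (let v = s div (m + 1) + 1 in
     pre_digraph.add_arc (pre_digraph.add_vert g v) (Suc s, v, v))"

lemma finite_pa_graphs: "finite (pa_graphs m t)"
proof (rule finite_subset)
  let ?V = "{1..(t + m) div (m + 1)}"
  let ?f = "\<lambda>A. \<lparr>verts = ?V, arcs = A, tail = (\<lambda>(s, u, v). u), head = (\<lambda>(s, u, v). v)\<rparr>"
  show "pa_graphs m t \<subseteq> ?f ` Pow ({1..t} \<times> ?V \<times> ?V)"
  proof
    fix g assume g: "g \<in> pa_graphs m t"
    then have "g = ?f (arcs g)"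
      unfolding pa_graphs_def by (intro pre_digraph.equality) auto
    moreover have "arcs g \<in> Pow ({1..t} \<times> ?V \<times> ?V)" using g unfolding pa_graphs_def by auto
    ultimately show "g \<in> ?f ` Pow ({1..t} \<times> ?V \<times> ?V)" by blast
  qed
  show "finite (?f ` Pow ({1..t} \<times> ?V \<times> ?V))" by simp
qed

lemma real_in_degree_count:
  assumes "finite (verts h)"
  shows "real (in_degree_count k h) = (\<Sum>v\<in>verts h. of_bool (in_degree h v = k))"
  using assms by (simp add: in_degree_count_def Int_def of_bool_def sum.If_cases)

context
  fixes m s :: nat and g :: multidigraph
  assumes g: "g \<in> pa_graphs m s"
begin

lemma pa_graphs_finite_verts: "finite (verts g)"
  and pa_graphs_head: "head g = (\<lambda>(s, u, v). v)"
  and pa_graphs_tail: "tail g = (\<lambda>(s, u, v). u)"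
  and pa_graphs_card_arcs: "card (arcs g) = s"
  and pa_graphs_finite_arcs: "finite (arcs g)"
  and pa_graphs_arcs: "arcs g \<subseteq> {1..s} \<times> verts g \<times> verts g"
  using g by (auto simp: pa_graphs_def dest: finite_subset)

lemma new_arc_notin: "(Suc s, u, v) \<notin> arcs g"
  using pa_graphs_arcs by auto

lemma pa_graphs_verts_attach:
  assumes "s mod (m + 1) \<noteq> 0"
  shows "verts g = {1..s div (m + 1) + 1}"
proof -
  have "(s + m) div (m + 1) = s div (m + 1) + 1"
  proof -
    let ?q = "s div (m + 1)" and ?r = "s mod (m + 1)"
    have s: "s = ?q * (m + 1) + ?r" by (metis div_mult_mod_eq)
    \<comment> \<open>The remainder is positive, so adding \<open>m\<close> carries into the
      quotient and leaves \<open>?r - 1\<close>.\<close>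
    have r: "?r - 1 < m + 1" "?r + m = (m + 1) + (?r - 1)"
      using assms mod_less_divisor[of "m + 1" s] by linarith+
    have "s + m = (?q + 1) * (m + 1) + (?r - 1)" using s r(2) by (simp add: algebra_simps)
    then have "(s + m) div (m + 1) = ((?q + 1) * (m + 1) + (?r - 1)) div (m + 1)" by (rule arg_cong)
    also have "\<dots> = ?q + 1" using r(1) by (subst div_mult_self3) auto
    finally show ?thesis .
  qed
  then show ?thesis using g unfolding pa_graphs_def by simp
qed

lemma pa_graphs_verts_loop:
  assumes "s mod (m + 1) = 0"
  shows "verts g = {1..s div (m + 1)}"
proof -
  have "s = s div (m + 1) * (m + 1)" using assms by (metis add_0_right div_mult_mod_eq)
  then have "(s + m) div (m + 1) = (s div (m + 1) * (m + 1) + m) div (m + 1)" by simp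
  also have "\<dots> = s div (m + 1)" by (subst div_mult_self3) auto
  finally show ?thesis using g unfolding pa_graphs_def by simp
qed

text \<open>Every arc has exactly one head, and it lies in \<open>verts g\<close>. Consequently the
  attachment probabilities sum to one.\<close>

lemma sum_in_degree_pa_graphs: "(\<Sum>v\<in>verts g. in_degree g v) = s"
proof -
  have "(\<Sum>v\<in>verts g. in_degree g v) = card (\<Union>v\<in>verts g. in_arcs g v)"
    unfolding in_degree_def
    by (subst card_UN_disjoint)
      (auto simp: pa_graphs_finite_verts intro: finite_subset[OF _ pa_graphs_finite_arcs])
  also have "(\<Union>v\<in>verts g. in_arcs g v) = arcs g"
    using pa_graphs_arcs by (auto simp: pa_graphs_head)
  finally show ?thesis by (simp add: pa_graphs_card_arcs)
qed

lemma in_degree_attach_arc: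
  "in_degree (attach_arc m s g j) v = in_degree g v + of_bool (v = j)"
proof -
  have "in_arcs (attach_arc m s g j) v
      = (if v = j then insert (Suc s, s div (m + 1) + 1, j) (in_arcs g v) else in_arcs g v)"
    unfolding attach_arc_def
    by (auto simp: in_arcs_def pre_digraph.add_arc_simps pre_digraph.add_arc_def pa_graphs_head)
  moreover have "finite (in_arcs g v)"
    using pa_graphs_finite_arcs by (rule finite_subset[rotated]) auto
  ultimately show ?thesis using new_arc_notin by (auto simp: in_degree_def)
qed

text \<open>\<open>add_arc\<close> also inserts both end vertices; the tail is already present,
  because it was created by the loop that opened the round.\<close>

lemma verts_attach_arc:
  assumes "s mod (m + 1) \<noteq> 0" "j \<in> verts g"
  shows "verts (attach_arc m s g j) = verts g"
proof -
  have "s div (m + 1) + 1 \<in> verts g" unfolding pa_graphs_verts_attach[OF assms(1)] by simp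
  moreover have "verts (attach_arc m s g j) = verts g \<union> {s div (m + 1) + 1, j}"
    unfolding attach_arc_def pre_digraph.add_arc_def by (simp add: pa_graphs_head pa_graphs_tail)
  ultimately show ?thesis using assms(2) by blast
qed

lemma attach_arc_in_pa_graphs:
  assumes "s mod (m + 1) \<noteq> 0" "j \<in> verts g"
  shows "attach_arc m s g j \<in> pa_graphs m (Suc s)"
proof -
  have "verts g = {1..(Suc s + m) div (m + 1)}"
    using pa_graphs_verts_attach[OF assms(1)] div_add_self2[of "m + 1" s] by simp
  moreover have "arcs (attach_arc m s g j) \<subseteq> {1..Suc s} \<times> verts g \<times> verts g"
  proof -
    have "s div (m + 1) + 1 \<in> verts g" unfolding pa_graphs_verts_attach[OF assms(1)] by simp
    moreover have "arcs (attach_arc m s g j) = insert (Suc s, s div (m + 1) + 1, j) (arcs g)"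
      unfolding attach_arc_def pre_digraph.add_arc_def by simp
    moreover have "arcs g \<subseteq> {1..Suc s} \<times> verts g \<times> verts g"
      using pa_graphs_arcs by (rule order_trans) (intro Sigma_mono, auto)
    ultimately show ?thesis using assms(2) by simp
  qed
  moreover have "card (arcs (attach_arc m s g j)) = Suc s"
    using pa_graphs_finite_arcs pa_graphs_card_arcs new_arc_notin
    by (simp add: attach_arc_def pre_digraph.add_arc_def)
  moreover have "head (attach_arc m s g j) = head g" "tail (attach_arc m s g j) = tail g"
    by (simp_all add: attach_arc_def pre_digraph.add_arc_def)
  ultimately show ?thesis
    unfolding pa_graphs_def using verts_attach_arc[OF assms] pa_graphs_head pa_graphs_tail by simp
qed

text \<open>Only the summand of \<open>j\<close> changes. For \<open>k = 0\<close> the truncated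
  \<open>k - 1\<close> would make the two indicators cancel and miss the loss of a vertex of
  in-degree 0.\<close>

lemma in_degree_count_attach_arc:
  assumes "s mod (m + 1) \<noteq> 0" "j \<in> verts g" "k \<ge> 1"
  shows "real (in_degree_count k (attach_arc m s g j)) = real (in_degree_count k g)
    + of_bool (in_degree g j = k - 1) - of_bool (in_degree g j = k)"
proof -
  let ?r = "\<Sum>v\<in>verts g - {j}. of_bool (in_degree g v = k) :: real"
  have "real (in_degree_count k (attach_arc m s g j))
      = (\<Sum>v\<in>verts g. of_bool (in_degree g v + of_bool (v = j) = k))"
    using pa_graphs_finite_verts
    by (simp add: real_in_degree_count verts_attach_arc[OF assms(1,2)] in_degree_attach_arc)
  also have "\<dots> = of_bool (in_degree g j + 1 = k) + ?r"
    using assms(2) pa_graphs_finite_verts by (subst sum.remove[of _ j]) auto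
  finally have 1: "real (in_degree_count k (attach_arc m s g j)) = of_bool (in_degree g j + 1 = k) + ?r" .
  have 2: "real (in_degree_count k g) = of_bool (in_degree g j = k) + ?r"
    unfolding real_in_degree_count[OF pa_graphs_finite_verts]
    using assms(2) pa_graphs_finite_verts by (subst sum.remove[of _ j]) auto
  show ?thesis unfolding 1 2 using assms(3) by auto
qed

text \<open>Divided by \<open>s\<close>, this is the probability that the next random arc hits a
  vertex of in-degree \<open>k\<close>; it turns the mean increment of a count into a linear
  expression in the counts.\<close>

lemma sum_in_degree_eq:
  "(\<Sum>v\<in>verts g. real (in_degree g v) * of_bool (in_degree g v = k)) = real k * real (in_degree_count k g)"
proof -
  have "(\<Sum>v\<in>verts g. real (in_degree g v) * of_bool (in_degree g v = k))
     = (\<Sum>v\<in>verts g. real k * of_bool (in_degree g v = k))"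
    by (intro sum.cong) auto
  also have "\<dots> = real k * (\<Sum>v\<in>verts g. of_bool (in_degree g v = k))"
    by (rule sum_distrib_left[symmetric])
  finally show ?thesis unfolding real_in_degree_count[OF pa_graphs_finite_verts] .
qed

text \<open>The new vertex is not in \<open>g\<close>, so no arc of \<open>g\<close> points to it:
  its loop is its only incoming arc, and all other in-degrees stay as they are.\<close>

lemma
  assumes "s mod (m + 1) = 0"
  shows add_loop_in_pa_graphs: "add_loop m s g \<in> pa_graphs m (Suc s)"
    and in_degree_count_add_loop:
      "k \<ge> 1 \<Longrightarrow> in_degree_count k (add_loop m s g) = in_degree_count k g + of_bool (k = 1)"
proof -
  let ?n = "s div (m + 1) + 1" and ?h = "add_loop m s g"
  note verts_g = pa_graphs_verts_loop[OF assms]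
  have arcs_h: "arcs ?h = insert (Suc s, ?n, ?n) (arcs g)"
    and verts_h: "verts ?h = insert ?n (verts g)"
    and head_h: "head ?h = head g" and tail_h: "tail ?h = tail g"
    unfolding add_loop_def Let_def pre_digraph.add_arc_def pre_digraph.add_vert_def
    by (simp_all add: pa_graphs_head pa_graphs_tail)
  have "verts ?h = {1..(Suc s + m) div (m + 1)}"
    unfolding verts_h verts_g using div_add_self2[of "m + 1" s] by (auto simp: atLeastAtMostSuc_conv)
  then show "add_loop m s g \<in> pa_graphs m (Suc s)"
    unfolding pa_graphs_def
    using pa_graphs_finite_arcs pa_graphs_card_arcs new_arc_notin pa_graphs_arcs verts_h
    by (auto simp: arcs_h head_h tail_h pa_graphs_head pa_graphs_tail)
  have n: "?n \<notin> verts g" by (simp add: verts_g)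
  have old: "in_arcs ?h v = in_arcs g v" if "v \<in> verts g" for v
    using that n by (auto simp: in_arcs_def arcs_h head_h pa_graphs_head)
  have new: "in_arcs ?h ?n = {(Suc s, ?n, ?n)}"
    using n pa_graphs_arcs by (auto simp: in_arcs_def arcs_h head_h pa_graphs_head)
  show "in_degree_count k ?h = in_degree_count k g + of_bool (k = 1)" if "k \<ge> 1"
  proof -
    have "{v \<in> verts ?h. in_degree ?h v = k}
        = {v \<in> verts g. in_degree g v = k} \<union> (if k = 1 then {?n} else {})"
      using old new by (auto simp: verts_h in_degree_def)
    then show ?thesis
      unfolding in_degree_count_def using n pa_graphs_finite_verts by auto
  qed
qed

end

text \<open>The new arc carries a fresh time stamp and therefore cannot be one of the old arcs. This
  makes the events of attaching to different vertices disjoint.\<close>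

lemma attach_arc_inject:
  assumes "g \<in> pa_graphs m s" and "attach_arc m s g i = attach_arc m s g j"
  shows "i = j"
proof -
  have arcs: "arcs (attach_arc m s g x) = insert (Suc s, s div (m + 1) + 1, x) (arcs g)" for x
    by (simp add: attach_arc_def pre_digraph.add_arc_def)
  have "(Suc s, s div (m + 1) + 1, i) \<in> insert (Suc s, s div (m + 1) + 1, j) (arcs g)"
    using arcs[of i] arcs[of j] assms(2) by (metis insertI1)
  then show ?thesis using new_arc_notin[OF assms(1), of "s div (m + 1) + 1" i] by simp
qed

lemma empty_graph_in_pa_graphs: "empty_graph \<in> pa_graphs m 0"
  by (simp add: empty_graph_def pa_graphs_def)

lemma abs_in_degree_count_attach_arc:
  assumes "g \<in> pa_graphs m s" "s mod (m + 1) \<noteq> 0" "j \<in> verts g" "k \<ge> 1"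
  shows "\<bar>real (in_degree_count k (attach_arc m s g j)) - real (in_degree_count k g)\<bar> \<le> 1"
  by (simp add: in_degree_count_attach_arc[OF assms])

subsection \<open>The centring sequence\<close>

definition pa_limit :: "nat \<Rightarrow> nat \<Rightarrow> real" where
  "pa_limit m k = (1 + 1 / real m) * Gamma (real k) * Gamma (2 + 1 / real m)
      / Gamma (real k + 2 + 1 / real m)"

text \<open>The increment of the centring sequence at each of the \<open>m\<close> random steps of a round.\<close>

definition pa_drift :: "nat \<Rightarrow> nat \<Rightarrow> real" where
  "pa_drift m k = (real (k - 1) * pa_limit m (k - 1) - real k * pa_limit m k) / real (m + 1)"

text \<open>Complete rounds contribute \<open>pa_limit m k\<close> each. Within a round the first
  step is the loop, which matters only for \<open>k = 1\<close>, and the remaining steps contribute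
  one drift each; hence the \<open>- 1\<close>, and the separate case of remainder 0, where the loop
  has not yet been added.\<close>

definition pa_centre :: "nat \<Rightarrow> nat \<Rightarrow> nat \<Rightarrow> real" where
  "pa_centre m k t = pa_limit m k * real (t div (m + 1)) + (if t mod (m + 1) = 0 then 0
     else of_bool (k = 1) + (real (t mod (m + 1)) - 1) * pa_drift m k)"

text \<open>This is the functional equation of \<open>Gamma\<close>, used in the numerator and in
  the denominator. With \<open>X = k + 1 + 1 / m\<close> the denominator is
  \<open>X * Gamma X\<close>, and \<open>Gamma X\<close> is also the denominator for
  \<open>k - 1\<close>. For \<open>k = 1\<close> it cancels against \<open>Gamma (2 + 1 / m)\<close>
  and leaves the boundary term.\<close>

lemma pa_limit_recurrence:
  assumes "m \<ge> 1" "k \<ge> 1"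
  shows "(real k + 1 + 1 / real m) * pa_limit m k
    = (1 + 1 / real m) * of_bool (k = 1) + real (k - 1) * pa_limit m (k - 1)"
proof -
  define a where "a = 1 / real m"
  define X where "X = real k + 1 + a"
  have a: "a > 0" using assms by (simp add: a_def)
  have X: "X > 0" using a of_nat_0_le_iff[of k] unfolding X_def by linarith
  have Gamma_Suc: "Gamma (x + 1) = x * Gamma x" if "x > 0" for x :: real
    using that by (intro Gamma_plus1) (auto dest: nonpos_Ints_nonpos)
  have den: "Gamma (real k + 2 + a) = X * Gamma X"
    using Gamma_Suc[OF X] by (simp add: X_def algebra_simps)
  have G: "Gamma X \<noteq> 0" using Gamma_real_pos[OF X] by simp
  have p: "X * pa_limit m k = (1 + a) * Gamma (real k) * Gamma (2 + a) / Gamma X"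
    unfolding pa_limit_def a_def[symmetric] den using X by simp
  have "X * pa_limit m k = (1 + a) * of_bool (k = 1) + real (k - 1) * pa_limit m (k - 1)"
  proof (cases "k = 1")
    case True
    then have "X = 2 + a" by (simp add: X_def)
    then show ?thesis unfolding p using G True by simp
  next
    case False
    then have k: "real (k - 1) + 1 = real k" "real (k - 1) > 0" using assms by auto
    have "real (k - 1) + 2 + a = X" using k(1) unfolding X_def by linarith
    then have "pa_limit m (k - 1) = (1 + a) * Gamma (real (k - 1)) * Gamma (2 + a) / Gamma X"
      unfolding pa_limit_def a_def[symmetric] by simp
    moreover have "Gamma (real k) = real (k - 1) * Gamma (real (k - 1))"
      using Gamma_Suc[OF k(2)] unfolding k(1) .
    ultimately show ?thesis unfolding p using False by simp
  qed
  then show ?thesis by (simp add: X_def a_def)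
qed

text \<open>The recurrence multiplied by \<open>m / (m + 1)\<close>: the \<open>m\<close> drifts of
  a round and its loop add up to the slope per round. So the centring sequence has the right
  increment also at the step that ends a round.\<close>

lemma pa_drift_round:
  assumes "m \<ge> 1" "k \<ge> 1"
  shows "real m * pa_drift m k + of_bool (k = 1) = pa_limit m k"
proof -
  let ?p = "pa_limit m k"
  have "real m * ((real k + 1 + 1 / real m) * ?p)
    = real m * ((1 + 1 / real m) * of_bool (k = 1) + real (k - 1) * pa_limit m (k - 1))"
    by (simp only: pa_limit_recurrence[OF assms])
  then have *: "(real m * real k + real m + 1) * ?p
      = (real m + 1) * of_bool (k = 1) + real m * (real (k - 1) * pa_limit m (k - 1))"
    using assms(1) by (simp add: algebra_simps)
  have "real (m + 1) * (real m * pa_drift m k + of_bool (k = 1))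
    = real m * (real (k - 1) * pa_limit m (k - 1) - real k * ?p) + (real m + 1) * of_bool (k = 1)"
    unfolding pa_drift_def by (simp add: field_simps)
  also have "\<dots> = real (m + 1) * ?p" using * by (simp add: algebra_simps)
  finally show ?thesis by simp
qed

lemma pa_centre_Suc_attach:
  assumes "m \<ge> 1" "k \<ge> 1" "s mod (m + 1) \<noteq> 0"
  shows "pa_centre m k (Suc s) = pa_centre m k s + pa_drift m k"
proof (cases "Suc (s mod (m + 1)) = m + 1")
  \<comment> \<open>The last step of a round: the remainder wraps to 0 and the quotient grows, so
    \<open>pa_drift_round\<close> is needed.\<close>
  case True
  then have "Suc s mod (m + 1) = 0" "Suc s div (m + 1) = Suc (s div (m + 1))" "s mod (m + 1) = m"
    by (auto simp: mod_Suc div_Suc)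
  then show ?thesis
    using assms by (simp add: pa_centre_def pa_drift_round[OF assms(1,2), symmetric] algebra_simps)
next
  case False
  then have "Suc s mod (m + 1) = Suc (s mod (m + 1))" "Suc s div (m + 1) = s div (m + 1)"
    by (auto simp: mod_Suc div_Suc)
  then show ?thesis
    using assms by (simp add: pa_centre_def algebra_simps)
qed

lemma pa_centre_Suc_loop:
  assumes "m \<ge> 1" "s mod (m + 1) = 0"
  shows "pa_centre m k (Suc s) = pa_centre m k s + of_bool (k = 1)"
proof -
  have "Suc s mod (m + 1) = 1" "Suc s div (m + 1) = s div (m + 1)"
    using assms by (auto simp: mod_Suc div_Suc)
  then show ?thesis using assms by (simp add: pa_centre_def)
qed

text \<open>The difference depends only on \<open>t mod (m + 1)\<close>, hence is bounded. The case
  \<open>k = 0\<close> is included, since the second moment estimate refers to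
  \<open>k - 1\<close>.\<close>

lemma pa_centre_linear:
  "\<exists>B\<ge>0. \<forall>t. \<bar>pa_centre m k t - pa_limit m k * real t / real (m + 1)\<bar> \<le> B"
proof (intro exI conjI allI)
  let ?B = "\<bar>pa_limit m k\<bar> + (1 + real m * \<bar>pa_drift m k\<bar>)"
  show "?B \<ge> 0" by simp
  fix t
  let ?q = "real (t div (m + 1))" and ?r = "real (t mod (m + 1))"
  have t: "real t = ?q * real (m + 1) + ?r"
    by (metis div_mult_mod_eq of_nat_add of_nat_mult)
  have r: "?r < real (m + 1)"
    by (simp only: of_nat_less_iff mod_less_divisor)
  have "pa_limit m k * real t / real (m + 1) = pa_limit m k * ?q + pa_limit m k * (?r / real (m + 1))"
    by (subst t) (simp add: field_simps)
  moreover have "\<bar>pa_limit m k * (?r / real (m + 1))\<bar> \<le> \<bar>pa_limit m k\<bar> * 1"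
    unfolding abs_mult using r by (intro mult_left_mono) auto
  moreover have "\<bar>if t mod (m + 1) = 0 then 0
     else of_bool (k = 1) + (?r - 1) * pa_drift m k\<bar> \<le> 1 + real m * \<bar>pa_drift m k\<bar>"
  proof (cases "t mod (m + 1) = 0")
    case False
    then have "\<bar>?r - 1\<bar> \<le> real m" using r by auto
    then have "\<bar>(?r - 1) * pa_drift m k\<bar> \<le> real m * \<bar>pa_drift m k\<bar>"
      unfolding abs_mult by (rule mult_right_mono) simp
    then show ?thesis using False by (auto simp: of_bool_def)
  qed simp
  ultimately show "\<bar>pa_centre m k t - pa_limit m k * real t / real (m + 1)\<bar> \<le> ?B"
    unfolding pa_centre_def by linarith
qed

subsection \<open>The process\<close>

lemma (in II_PA) graph_event [measurable]: "{\<omega> \<in> space M. G t \<omega> = x} \<in> events"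
proof -
  have "G t -` {x} \<inter> space M \<in> events" by (rule measurable_sets[OF random_graph]) simp
  also have "G t -` {x} \<inter> space M = {\<omega> \<in> space M. G t \<omega> = x}" by auto
  finally show ?thesis .
qed

lemma (in II_PA) history_event: "{\<omega> \<in> space M. \<forall>s<t. G s \<omega> = g s} \<in> events"
  by (rule sets.sets_Collect_countable_All) (intro sets.sets_Collect_imp sets.sets_Collect_const graph_event)

lemma (in II_PA) measurable_graph [measurable]: "random_variable borel (\<lambda>\<omega>. F (G t \<omega>) :: real)"
  by (rule measurable_compose[OF random_graph]) simp

section \<open>The one-step transition law\<close>

context II_PA
begin

text \<open>The Markov property: \<open>attach\<close> conditions on the whole history, but its
  value depends only on the last graph, so one may sum over the finitely many histories ending in
  \<open>h\<close>. \<open>AE_past\<close> is a hypothesis because the lemma serves in the induction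
  that establishes it.\<close>

lemma prob_attach_arc:
  assumes "s mod (m + 1) \<noteq> 0"
    and AE_past: "\<forall>u\<le>s. AE \<omega> in M. G u \<omega> \<in> pa_graphs m u"
    and h: "h \<in> pa_graphs m s" and j: "j \<in> verts h"
  shows "\<P>(\<omega> in M. G s \<omega> = h \<and> G (Suc s) \<omega> = attach_arc m s h j)
    = \<P>(\<omega> in M. G s \<omega> = h) * (real (in_degree h j) / real s)"
proof -
  \<comment> \<open>Extensional functions on \<open>{..s}\<close>, so that almost every outcome with
    \<open>G s \<omega> = h\<close> matches exactly one history.\<close>
  define H where "H = {g \<in> PiE {..s} (pa_graphs m). g s = h}"
  have finH: "finite H"
    unfolding H_def by (intro finite_subset[OF _ finite_PiE[of "{..s}" "pa_graphs m"]]) (auto simp: finite_pa_graphs)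
  define E where "E g \<omega> \<longleftrightarrow> (\<forall>u<Suc s. G u \<omega> = g u)" for g \<omega>
  let ?A = "\<lambda>\<omega>. G (Suc s) \<omega> = attach_arc m s h j"
  have evE: "{\<omega> \<in> space M. E g \<omega>} \<in> events" for g
    unfolding E_def by (rule history_event)
  have evA: "{\<omega> \<in> space M. ?A \<omega>} \<in> events" by (rule graph_event)
  have past: "AE \<omega> in M. \<forall>u\<in>{..s}. G u \<omega> \<in> pa_graphs m u"
    using AE_past by (intro AE_finite_allI) auto
  have unique: "AE \<omega> in M. G s \<omega> = h \<longrightarrow> (\<exists>!g\<in>H. E g \<omega>)"
    using past
  proof eventually_elim
    case (elim \<omega>)
    show ?case
    proof
      assume hs: "G s \<omega> = h"
      show "\<exists>!g\<in>H. E g \<omega>"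
      proof (rule ex1I[of _ "restrict (\<lambda>u. G u \<omega>) {..s}"])
        show "restrict (\<lambda>u. G u \<omega>) {..s} \<in> H \<and> E (restrict (\<lambda>u. G u \<omega>) {..s}) \<omega>"
          using elim hs unfolding H_def E_def by auto
        fix g assume g: "g \<in> H \<and> E g \<omega>"
        then have "g \<in> extensional {..s}" unfolding H_def by (auto simp: PiE_def)
        then show "g = restrict (\<lambda>u. G u \<omega>) {..s}"
          using g unfolding E_def by (intro extensionalityI[of g "{..s}"]) auto
      qed
    qed
  qed
  have E_h: "G s \<omega> = h" if "g \<in> H" "E g \<omega>" for g \<omega>
    using that unfolding H_def E_def by auto
  have tot: "\<P>(\<omega> in M. G s \<omega> = h) = (\<Sum>g\<in>H. \<P>(\<omega> in M. E g \<omega>))"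
    using unique by (intro prob_sum finH evE graph_event) (auto dest: E_h)
  have "\<P>(\<omega> in M. G s \<omega> = h \<and> ?A \<omega>) = (\<Sum>g\<in>H. \<P>(\<omega> in M. E g \<omega> \<and> ?A \<omega>))"
  proof (intro prob_sum finH sets.sets_Collect_conj evE evA graph_event)
    show "AE \<omega> in M. (\<forall>g\<in>H. E g \<omega> \<and> ?A \<omega> \<longrightarrow> G s \<omega> = h \<and> ?A \<omega>)
      \<and> (G s \<omega> = h \<and> ?A \<omega> \<longrightarrow> (\<exists>!g\<in>H. E g \<omega> \<and> ?A \<omega>))"
      using unique by eventually_elim (use E_h in blast)
  qed
  also have "\<dots> = (\<Sum>g\<in>H. \<P>(\<omega> in M. E g \<omega>) * (real (in_degree h j) / real s))"
  proof (rule sum.cong[OF refl])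
    fix g assume g: "g \<in> H"
    then have gs: "g s = h" unfolding H_def by simp
    show "\<P>(\<omega> in M. E g \<omega> \<and> ?A \<omega>) = \<P>(\<omega> in M. E g \<omega>) * (real (in_degree h j) / real s)"
    proof (cases "\<P>(\<omega> in M. E g \<omega>) > 0")
      case True
      \<comment> \<open>The position within the round of the arc added at time \<open>Suc s\<close>;
        it is at least 2 because the remainder of \<open>s\<close> is nonzero.\<close>
      define i where "i = s mod (m + 1) + 1"
      have i: "i \<in> {2..m + 1}"
        using assms(1) mod_less_divisor[of "m + 1" s] by (simp add: i_def)
      have t: "Suc s = s div (m + 1) * (m + 1) + i"
        unfolding i_def by (metis Suc_eq_plus1 add.assoc div_mult_mod_eq)
      have jj: "j \<in> {1..s div (m + 1) + 1}" using j pa_graphs_verts_attach[OF h assms(1)] by simp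
      have "\<P>(\<omega> in M. G (Suc s) \<omega> = pre_digraph.add_arc (G (Suc s - 1) \<omega>) (Suc s, s div (m + 1) + 1, j)
          \<bar> \<forall>u<Suc s. G u \<omega> = g u) = real (in_degree (g (Suc s - 1)) j) / real (Suc s - 1)"
        by (rule attach[OF i t jj]) (use True in \<open>simp add: E_def\<close>)
      moreover have "{\<omega> \<in> space M. G (Suc s) \<omega> = pre_digraph.add_arc (G (Suc s - 1) \<omega>) (Suc s, s div (m + 1) + 1, j)
          \<and> E g \<omega>} = {\<omega> \<in> space M. E g \<omega> \<and> ?A \<omega>}"
        using E_h[OF g] by (auto simp: attach_arc_def)
      ultimately have "\<P>(\<omega> in M. E g \<omega> \<and> ?A \<omega>) / \<P>(\<omega> in M. E g \<omega>) = real (in_degree h j) / real s"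
        unfolding cond_prob_def E_def[symmetric] by (simp add: gs)
      then show ?thesis using True by (simp add: field_simps)
    next
      \<comment> \<open>\<open>attach\<close> says nothing about histories of probability zero, but
        for them both sides are 0.\<close>
      case False
      then have zero: "\<P>(\<omega> in M. E g \<omega>) = 0" by (simp add: not_less measure_le_0_iff)
      have "\<P>(\<omega> in M. E g \<omega> \<and> ?A \<omega>) \<le> \<P>(\<omega> in M. E g \<omega>)"
        by (rule finite_measure_mono[OF _ evE]) auto
      then show ?thesis using zero by (simp add: measure_le_0_iff)
    qed
  qed
  also have "\<dots> = \<P>(\<omega> in M. G s \<omega> = h) * (real (in_degree h j) / real s)"
    unfolding tot by (rule sum_distrib_right[symmetric])
  finally show ?thesis .
qed

text \<open>The model only prescribes the probabilities of the single attachments. The corresponding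
  events, indexed by the present graph and the chosen vertex, are disjoint, and their probabilities
  sum to one by the sum of the in-degrees; so almost surely one of them occurs.\<close>

lemma AE_attach_arc:
  assumes "s mod (m + 1) \<noteq> 0"
    and AE_past: "\<forall>u\<le>s. AE \<omega> in M. G u \<omega> \<in> pa_graphs m u"
  shows "AE \<omega> in M. \<exists>j\<in>verts (G s \<omega>). G (Suc s) \<omega> = attach_arc m s (G s \<omega>) j"
proof -
  let ?I = "Sigma (pa_graphs m s) verts"
  let ?P = "\<lambda>i \<omega>. G s \<omega> = fst i \<and> G (Suc s) \<omega> = attach_arc m s (fst i) (snd i)"
  have s: "s > 0" using assms(1) by (cases s) auto
  have finI: "finite ?I"
    by (intro finite_SigmaI finite_pa_graphs) (rule pa_graphs_finite_verts)
  have evP: "{\<omega> \<in> space M. ?P i \<omega>} \<in> events" for i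
    by (intro sets.sets_Collect_conj graph_event)
  have present: "AE \<omega> in M. G s \<omega> \<in> pa_graphs m s" using AE_past by simp
  have evQ: "{\<omega> \<in> space M. \<exists>i\<in>?I. ?P i \<omega>} \<in> events"
    using finI evP by (intro sets.sets_Collect_finite_Ex)
  have "\<P>(\<omega> in M. \<exists>i\<in>?I. ?P i \<omega>) = (\<Sum>i\<in>?I. \<P>(\<omega> in M. ?P i \<omega>))"
  proof (intro prob_sum finI evP evQ AE_I2 conjI impI)
    fix \<omega> assume "\<exists>i\<in>?I. ?P i \<omega>"
    then obtain i where i: "i \<in> ?I" "?P i \<omega>" by blast
    show "\<exists>!i\<in>?I. ?P i \<omega>"
    proof (rule ex1I[of _ i])
      show "i \<in> ?I \<and> ?P i \<omega>" using i by blast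
      fix i' assume i': "i' \<in> ?I \<and> ?P i' \<omega>"
      then have "fst i' = fst i" using i(2) by simp
      moreover have "snd i' = snd i"
        using i i' by (intro attach_arc_inject[of "fst i" m s]) auto
      ultimately show "i' = i" by (rule prod_eqI)
    qed
  qed blast
  also have "\<dots> = (\<Sum>(h, j)\<in>?I. \<P>(\<omega> in M. G s \<omega> = h) * (real (in_degree h j) / real s))"
    using prob_attach_arc[OF assms] by (intro sum.cong) auto
  also have "\<dots> = (\<Sum>h\<in>pa_graphs m s. \<Sum>j\<in>verts h. \<P>(\<omega> in M. G s \<omega> = h) * (real (in_degree h j) / real s))"
    by (rule sum.Sigma[symmetric]) (auto simp: finite_pa_graphs dest: pa_graphs_finite_verts)
  also have "\<dots> = (\<Sum>h\<in>pa_graphs m s. \<P>(\<omega> in M. G s \<omega> = h))"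
  proof (rule sum.cong[OF refl])
    fix h assume h: "h \<in> pa_graphs m s"
    have "(\<Sum>j\<in>verts h. real (in_degree h j) / real s) = 1"
      using sum_in_degree_pa_graphs[OF h] s
      by (simp flip: sum_divide_distrib of_nat_sum)
    then show "(\<Sum>j\<in>verts h. \<P>(\<omega> in M. G s \<omega> = h) * (real (in_degree h j) / real s)) = \<P>(\<omega> in M. G s \<omega> = h)"
      by (simp only: mult_1_right flip: sum_distrib_left)
  qed
  also have "\<dots> = \<P>(\<omega> in M. True)"
    using present by (intro prob_sum[symmetric] finite_pa_graphs graph_event) auto
  also have "\<dots> = 1" using prob_space by simp
  finally have "AE \<omega> in M. \<exists>i\<in>?I. ?P i \<omega>"
    using prob_Collect_eq_1[OF evQ] by simp
  then show ?thesis
    by eventually_elim auto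
qed

lemma AE_add_loop:
  assumes "s mod (m + 1) = 0"
  shows "AE \<omega> in M. G (Suc s) \<omega> = add_loop m s (G s \<omega>)"
proof -
  have "s = s div (m + 1) * (m + 1)" using assms by (metis add_0_right div_mult_mod_eq)
  then have "Suc s = s div (m + 1) * (m + 1) + 1" by simp
  from new_vertex[OF this] show ?thesis by (simp add: add_loop_def Let_def)
qed

text \<open>The induction is a strong one, since a random step uses the claim for all earlier
  times.\<close>

lemma AE_pa_graphs: "AE \<omega> in M. G t \<omega> \<in> pa_graphs m t"
proof (induction t rule: less_induct)
  case (less t)
  show ?case
  proof (cases t)
    case 0
    then show ?thesis using start empty_graph_in_pa_graphs[of m] by (auto elim: eventually_mono)
  next
    case (Suc s)
    have past: "\<forall>u\<le>s. AE \<omega> in M. G u \<omega> \<in> pa_graphs m u"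
      using less.IH Suc by simp
    then have present: "AE \<omega> in M. G s \<omega> \<in> pa_graphs m s" by simp
    show ?thesis
    proof (cases "s mod (m + 1) = 0")
      case True
      show ?thesis
        using present AE_add_loop[OF True]
        by eventually_elim (simp only: Suc add_loop_in_pa_graphs[OF _ True])
    next
      case False
      show ?thesis
        using present AE_attach_arc[OF False past]
      proof eventually_elim
        case (elim \<omega>)
        then obtain j where "j \<in> verts (G s \<omega>)" "G (Suc s) \<omega> = attach_arc m s (G s \<omega>) j" by blast
        then show ?case using attach_arc_in_pa_graphs[OF elim(1) False] Suc by simp
      qed
    qed
  qed
qed

lemma integrable_graph: "integrable M (\<lambda>\<omega>. F (G t \<omega>) :: real)"
  by (rule expectation_finite_partition(1)[where P = "\<lambda>h \<omega>. G t \<omega> = h" and c = F, OF finite_pa_graphs[of m t]])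
    (use AE_pa_graphs[of t] in auto)

text \<open>The tower property for one random step, with the inner conditional mean given the
  present graph written out as a finite sum. Both sides are evaluated on finite partitions: by graph
  and chosen vertex on the left, by graph alone on the right.\<close>

lemma expectation_attach_arc:
  assumes "s mod (m + 1) \<noteq> 0"
  shows "expectation (\<lambda>\<omega>. F (G (Suc s) \<omega>) :: real)
    = expectation (\<lambda>\<omega>. \<Sum>j\<in>verts (G s \<omega>). real (in_degree (G s \<omega>) j) / real s * F (attach_arc m s (G s \<omega>) j))"
proof -
  let ?I = "Sigma (pa_graphs m s) verts"
  let ?P = "\<lambda>i \<omega>. G s \<omega> = fst i \<and> G (Suc s) \<omega> = attach_arc m s (fst i) (snd i)"
  let ?S = "\<lambda>h. \<Sum>j\<in>verts h. real (in_degree h j) / real s * F (attach_arc m s h j)"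
  have finI: "finite ?I"
    by (intro finite_SigmaI finite_pa_graphs) (rule pa_graphs_finite_verts)
  have evP: "{\<omega> \<in> space M. ?P i \<omega>} \<in> events" for i
    by (intro sets.sets_Collect_conj graph_event)
  have part: "AE \<omega> in M. \<exists>!i. i \<in> ?I \<and> ?P i \<omega>"
    using AE_pa_graphs[of s] AE_attach_arc[OF assms allI[OF impI[OF AE_pa_graphs]]]
  proof eventually_elim
    case (elim \<omega>)
    then obtain j where j: "j \<in> verts (G s \<omega>)" "G (Suc s) \<omega> = attach_arc m s (G s \<omega>) j" by blast
    show ?case
    proof (rule ex1I[of _ "(G s \<omega>, j)"])
      show "(G s \<omega>, j) \<in> ?I \<and> ?P (G s \<omega>, j) \<omega>" using j elim(1) by simp
      fix i assume i: "i \<in> ?I \<and> ?P i \<omega>"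
      then have "snd i = j"
        using j(2) elim(1) by (intro attach_arc_inject[of "G s \<omega>" m s]) auto
      then show "i = (G s \<omega>, j)" using i by (metis prod.collapse)
    qed
  qed
  have "expectation (\<lambda>\<omega>. F (G (Suc s) \<omega>)) = (\<Sum>i\<in>?I. F (attach_arc m s (fst i) (snd i)) * \<P>(\<omega> in M. ?P i \<omega>))"
    by (rule expectation_finite_partition(2)[OF finI evP part]) auto
  also have "\<dots> = (\<Sum>(h, j)\<in>?I. real (in_degree h j) / real s * F (attach_arc m s h j) * \<P>(\<omega> in M. G s \<omega> = h))"
    using prob_attach_arc[OF assms] AE_pa_graphs by (intro sum.cong) (auto simp: mult_ac)
  also have "\<dots> = (\<Sum>h\<in>pa_graphs m s. \<Sum>j\<in>verts h. real (in_degree h j) / real s * F (attach_arc m s h j) * \<P>(\<omega> in M. G s \<omega> = h))"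
    by (rule sum.Sigma[symmetric]) (auto simp: finite_pa_graphs dest: pa_graphs_finite_verts)
  also have "\<dots> = (\<Sum>h\<in>pa_graphs m s. ?S h * \<P>(\<omega> in M. G s \<omega> = h))"
    by (simp only: sum_distrib_right)
  also have "\<dots> = expectation (\<lambda>\<omega>. ?S (G s \<omega>))"
    by (rule expectation_finite_partition(2)[symmetric, where P = "\<lambda>h \<omega>. G s \<omega> = h", OF finite_pa_graphs])
      (use AE_pa_graphs[of s] in auto)
  finally show ?thesis .
qed

end

subsection \<open>Second moments\<close>

text \<open>The new deviation is \<open>x + (\<Delta> j - \<gamma>)\<close>, with \<open>x\<close>
  the old one and \<open>\<gamma>\<close> the drift. After squaring and averaging, the last term is
  bounded, and the cross term is controlled by the negative contribution \<open>- k * x\<close> to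
  \<open>s\<close> times the mean increment.\<close>

lemma second_moment_attach_arc:
  assumes m: "m \<ge> 1" and k: "k \<ge> 1" and s: "s mod (m + 1) \<noteq> 0" and h: "h \<in> pa_graphs m s"
    and lin: "\<And>l. l \<in> {k - 1, k} \<Longrightarrow> \<bar>pa_centre m l s - pa_limit m l * real s / real (m + 1)\<bar> \<le> B"
  defines "D \<equiv> \<lambda>k t g. real (in_degree_count k g) - pa_centre m k t"
  shows "(\<Sum>j\<in>verts h. real (in_degree h j) / real s * (D k (Suc s) (attach_arc m s h j))\<^sup>2)
    \<le> (D k s h)\<^sup>2 + (real (k - 1) * (D (k - 1) s h)\<^sup>2 + (2 * real k * B)\<^sup>2) / real s
      + (1 + \<bar>pa_drift m k\<bar>)\<^sup>2"
proof -
  let ?w = "\<lambda>j. real (in_degree h j) / real s"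
  let ?\<gamma> = "pa_drift m k"
  define \<Delta> where "\<Delta> j = of_bool (in_degree h j = k - 1) - (of_bool (in_degree h j = k) :: real)" for j
  define x where "x = D k s h"
  define y where "y = D (k - 1) s h"
  have s0: "real s > 0" using s by (cases s) auto
  have step: "D k (Suc s) (attach_arc m s h j) = x + (\<Delta> j - ?\<gamma>)" if "j \<in> verts h" for j
    unfolding D_def x_def \<Delta>_def
    by (simp add: in_degree_count_attach_arc[OF h s that k] pa_centre_Suc_attach[OF m k s])
  have sum_w: "(\<Sum>j\<in>verts h. ?w j) = 1"
    using sum_in_degree_pa_graphs[OF h] s0
    by (simp flip: sum_divide_distrib of_nat_sum)
  have sum_\<Delta>: "(\<Sum>j\<in>verts h. ?w j * \<Delta> j)
    = (real (k - 1) * real (in_degree_count (k - 1) h) - real k * real (in_degree_count k h)) / real s"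
  proof -
    have "(\<Sum>j\<in>verts h. ?w j * \<Delta> j) = ((\<Sum>j\<in>verts h. real (in_degree h j) * of_bool (in_degree h j = k - 1))
       - (\<Sum>j\<in>verts h. real (in_degree h j) * of_bool (in_degree h j = k))) / real s"
      unfolding \<Delta>_def sum_divide_distrib sum_subtractf[symmetric]
      by (intro sum.cong) (auto simp: algebra_simps diff_divide_distrib)
    then show ?thesis by (simp only: sum_in_degree_eq[OF h])
  qed
  \<comment> \<open>The amount by which the centring sequence fails to satisfy the mean recursion,
    multiplied by \<open>s\<close>.\<close>
  define \<epsilon> where "\<epsilon> = real (k - 1) * pa_centre m (k - 1) s - real k * pa_centre m k s - real s * ?\<gamma>"
  define R where "R = (\<Sum>j\<in>verts h. ?w j * (\<Delta> j - ?\<gamma>))"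
  have R: "real s * R = real (k - 1) * y - real k * x + \<epsilon>"
  proof -
    have "R = (\<Sum>j\<in>verts h. ?w j * \<Delta> j) - ?\<gamma> * (\<Sum>j\<in>verts h. ?w j)"
      unfolding R_def sum_distrib_left sum_subtractf[symmetric]
      by (rule sum.cong[OF refl]) (simp only: right_diff_distrib mult.commute[of ?\<gamma>])
    also have "\<dots> = (real (k - 1) * real (in_degree_count (k - 1) h) - real k * real (in_degree_count k h)) / real s - ?\<gamma>"
      unfolding sum_\<Delta> sum_w by simp
    finally show ?thesis
      unfolding x_def y_def D_def \<epsilon>_def using s0 by (simp add: field_simps)
  qed
  \<comment> \<open>By the definition of the drift the linear parts cancel against
    \<open>s * \<gamma>\<close>; only the bounded remainders \<open>u\<close> and \<open>v\<close>,
    with weights \<open>k - 1\<close> and \<open>k\<close>, are left.\<close>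
  have \<epsilon>_bound: "\<bar>\<epsilon>\<bar> \<le> 2 * real k * B"
  proof -
    define u where "u = pa_centre m (k - 1) s - pa_limit m (k - 1) * real s / real (m + 1)"
    define v where "v = pa_centre m k s - pa_limit m k * real s / real (m + 1)"
    have "\<epsilon> = real (k - 1) * u - real k * v"
      unfolding \<epsilon>_def u_def v_def pa_drift_def by (simp add: algebra_simps diff_divide_distrib)
    then have "\<bar>\<epsilon>\<bar> \<le> \<bar>real (k - 1) * u\<bar> + \<bar>real k * v\<bar>" by linarith
    also have "\<dots> \<le> real k * B + real k * B"
      unfolding abs_mult using lin[of "k - 1"] lin[of k]
      by (intro add_mono mult_mono) (auto simp: u_def v_def)
    finally show ?thesis by (simp add: mult_ac)
  qed
  \<comment> \<open>The inequalities \<open>2 * x * y <= x^2 + y^2\<close> and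
    \<open>2 * x * \<epsilon> <= x^2 + \<epsilon>^2\<close> cost
    \<open>(k - 1) * x^2 + x^2 = k * x^2\<close>, which the term \<open>- 2 * k * x^2\<close>
    absorbs.\<close>
  have "2 * x * (real s * R) \<le> real (k - 1) * y\<^sup>2 + (2 * real k * B)\<^sup>2"
  proof -
    have "2 * x * \<epsilon> \<le> x\<^sup>2 + \<epsilon>\<^sup>2" using sum_squares_bound[of x \<epsilon>] by simp
    moreover have "\<epsilon>\<^sup>2 \<le> (2 * real k * B)\<^sup>2"
      using power_mono[OF \<epsilon>_bound abs_ge_zero, of 2] unfolding power2_abs .
    moreover have "real (k - 1) * (2 * x * y) \<le> real (k - 1) * (x\<^sup>2 + y\<^sup>2)"
      using sum_squares_bound[of x y] by (intro mult_left_mono) auto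
    moreover have "real k * x\<^sup>2 = real (k - 1) * x\<^sup>2 + x\<^sup>2"
      using k by (simp add: of_nat_diff algebra_simps)
    moreover have "2 * x * (real s * R) = real (k - 1) * (2 * x * y) - 2 * (real k * x\<^sup>2) + 2 * x * \<epsilon>"
      unfolding R by (simp add: power2_eq_square algebra_simps)
    moreover have "real (k - 1) * (x\<^sup>2 + y\<^sup>2) = real (k - 1) * x\<^sup>2 + real (k - 1) * y\<^sup>2"
      by (simp add: algebra_simps)
    moreover have "real (k - 1) * x\<^sup>2 \<ge> 0" "x\<^sup>2 \<ge> 0" by auto
    ultimately show ?thesis by linarith
  qed
  then have cross: "2 * x * R \<le> (real (k - 1) * y\<^sup>2 + (2 * real k * B)\<^sup>2) / real s"
    using s0 by (simp add: pos_le_divide_eq mult_ac)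
  have sq: "w * (x + d)\<^sup>2 = w * x\<^sup>2 + 2 * x * (w * d) + w * d\<^sup>2" for w d :: real
    by (simp add: power2_eq_square algebra_simps)
  have "(\<Sum>j\<in>verts h. ?w j * (D k (Suc s) (attach_arc m s h j))\<^sup>2)
    = (\<Sum>j\<in>verts h. ?w j * x\<^sup>2 + 2 * x * (?w j * (\<Delta> j - ?\<gamma>)) + ?w j * (\<Delta> j - ?\<gamma>)\<^sup>2)"
    by (rule sum.cong[OF refl]) (simp only: step sq)
  also have "\<dots> = x\<^sup>2 + 2 * x * R + (\<Sum>j\<in>verts h. ?w j * (\<Delta> j - ?\<gamma>)\<^sup>2)"
    unfolding sum.distrib R_def by (simp only: flip: sum_distrib_left sum_distrib_right) (simp only: sum_w mult_1_left)
  also have "(\<Sum>j\<in>verts h. ?w j * (\<Delta> j - ?\<gamma>)\<^sup>2) \<le> (\<Sum>j\<in>verts h. ?w j * (1 + \<bar>?\<gamma>\<bar>)\<^sup>2)"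
  proof (intro sum_mono mult_left_mono)
    fix j
    have "\<bar>\<Delta> j\<bar> \<le> 1" by (simp add: \<Delta>_def)
    then have "\<bar>\<Delta> j - ?\<gamma>\<bar> \<le> \<bar>1 + \<bar>?\<gamma>\<bar>\<bar>" by linarith
    then show "(\<Delta> j - ?\<gamma>)\<^sup>2 \<le> (1 + \<bar>?\<gamma>\<bar>)\<^sup>2" by (rule abs_le_square_iff[THEN iffD1])
  qed simp
  also have "\<dots> = (1 + \<bar>?\<gamma>\<bar>)\<^sup>2"
    by (simp only: sum_w mult_1_left flip: sum_distrib_right)
  finally show ?thesis using cross unfolding x_def y_def by linarith
qed

context II_PA
begin

text \<open>Loop steps leave the deviation unchanged, as the count and its centre grow alike. Each
  random step adds at most a constant, because the induction hypothesis bounds the coupling term of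
  order \<open>(k - 1) / s\<close> times the second moment for \<open>k - 1\<close>.\<close>

lemma second_moment_linear:
  assumes m: "m \<ge> 1" and "k \<ge> 1"
  shows "\<exists>C\<ge>0. \<forall>t. expectation (\<lambda>\<omega>. (real (in_degree_count k (G t \<omega>)) - pa_centre m k t)\<^sup>2) \<le> C * real t"
  using assms(2)
proof (induction k rule: less_induct)
  case (less k)
  let ?D = "\<lambda>k t g. real (in_degree_count k g) - pa_centre m k t"
  let ?E = "\<lambda>k t. expectation (\<lambda>\<omega>. (?D k t (G t \<omega>))\<^sup>2)"
  \<comment> \<open>The factor \<open>k - 1\<close> is kept inside the bound: for
    \<open>k = 1\<close> it vanishes, so nothing about in-degree 0 is required and the induction
    starts there.\<close>
  obtain C where C: "C \<ge> 0" "\<And>t. real (k - 1) * ?E (k - 1) t \<le> C * real t"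
  proof (cases "k = 1")
    case True
    then show ?thesis by (intro that[of 0]) auto
  next
    case False
    then have "k - 1 < k" "k - 1 \<ge> 1" using less.prems by auto
    from less.IH[OF this] obtain C' where C': "C' \<ge> 0" "\<And>t. ?E (k - 1) t \<le> C' * real t" by blast
    show ?thesis
    proof (rule that[of "real (k - 1) * C'"])
      show "real (k - 1) * ?E (k - 1) t \<le> real (k - 1) * C' * real t" for t
        unfolding mult.assoc by (intro mult_left_mono C') simp
    qed (use C' in simp)
  qed
  obtain B1 where B1: "B1 \<ge> 0" "\<And>t. \<bar>pa_centre m k t - pa_limit m k * real t / real (m + 1)\<bar> \<le> B1"
    using pa_centre_linear[of m k] by blast
  obtain B2 where B2: "B2 \<ge> 0"
      "\<And>t. \<bar>pa_centre m (k - 1) t - pa_limit m (k - 1) * real t / real (m + 1)\<bar> \<le> B2"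
    using pa_centre_linear[of m "k - 1"] by blast
  have lin: "\<bar>pa_centre m l t - pa_limit m l * real t / real (m + 1)\<bar> \<le> B1 + B2" if "l \<in> {k - 1, k}" for l t
    using that B1(1) B2(1) B1(2)[of t] B2(2)[of t] by (elim insertE) (auto simp only: empty_iff)
  define c1 where "c1 = (2 * real k * (B1 + B2))\<^sup>2"
  define c2 where "c2 = (1 + \<bar>pa_drift m k\<bar>)\<^sup>2"
  have c: "c1 \<ge> 0" "c2 \<ge> 0" by (simp_all add: c1_def c2_def)
  have "?E k t \<le> (C + c1 + c2) * real t" for t
  proof (induction t)
    case 0
    have "AE \<omega> in M. (?D k 0 (G 0 \<omega>))\<^sup>2 = 0"
      using start by eventually_elim (simp add: empty_graph_def in_degree_count_def pa_centre_def)
    then show ?case by (simp add: integral_eq_zero_AE)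
  next
    case (Suc s)
    show ?case
    proof (cases "s mod (m + 1) = 0")
      case True
      have "?E k (Suc s) = ?E k s"
      proof (rule integral_cong_AE[OF measurable_graph measurable_graph])
        show "AE \<omega> in M. (?D k (Suc s) (G (Suc s) \<omega>))\<^sup>2 = (?D k s (G s \<omega>))\<^sup>2"
          using AE_pa_graphs[of s] AE_add_loop[OF True]
          by eventually_elim
            (simp add: in_degree_count_add_loop[OF _ True less.prems] pa_centre_Suc_loop[OF m True])
      qed
      also have "\<dots> \<le> (C + c1 + c2) * real s" by (rule Suc.IH)
      also have "\<dots> \<le> (C + c1 + c2) * real (Suc s)" using C(1) c by (intro mult_left_mono) auto
      finally show ?thesis .
    next
      case False
      have s: "real s \<ge> 1" using False by (cases s) auto
      have int: "integrable M (\<lambda>\<omega>. (?D l s (G s \<omega>))\<^sup>2)" for l by (rule integrable_graph)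
      let ?R = "\<lambda>g. (?D k s g)\<^sup>2 + (real (k - 1) * (?D (k - 1) s g)\<^sup>2 + c1) / real s + c2"
      have "?E k (Suc s) = expectation (\<lambda>\<omega>. \<Sum>j\<in>verts (G s \<omega>). real (in_degree (G s \<omega>) j) / real s
          * (?D k (Suc s) (attach_arc m s (G s \<omega>) j))\<^sup>2)"
        by (rule expectation_attach_arc[OF False])
      also have "\<dots> \<le> expectation (\<lambda>\<omega>. ?R (G s \<omega>))"
      proof (rule integral_mono_AE)
        show "AE \<omega> in M. (\<Sum>j\<in>verts (G s \<omega>). real (in_degree (G s \<omega>) j) / real s
          * (?D k (Suc s) (attach_arc m s (G s \<omega>) j))\<^sup>2) \<le> ?R (G s \<omega>)"
          using AE_pa_graphs[of s] unfolding c1_def c2_def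
          by eventually_elim (rule second_moment_attach_arc[OF m less.prems False _ lin])
      qed (rule integrable_graph)+
      also have "\<dots> = ?E k s + (real (k - 1) * ?E (k - 1) s + c1) / real s + c2"
        using int prob_space by simp
      \<comment> \<open>Since \<open>s >= 1\<close>, \<open>c1\<close> may be enlarged to
        \<open>c1 * s\<close>; the quotient then equals \<open>C + c1\<close>.\<close>
      also have "\<dots> \<le> (C + c1 + c2) * real s + (C * real s + c1 * real s) / real s + c2"
        using s c(1) mult_left_mono[OF s c(1)]
        by (intro add_mono divide_right_mono Suc.IH C(2)) auto
      also have "\<dots> = (C + c1 + c2) * real (Suc s)" using s by (simp add: field_simps)
      finally show ?thesis .
    qed
  qed
  then show ?case using C(1) c by (intro exI[of _ "C + c1 + c2"]) auto
qed

section \<open>Almost sure convergence\<close>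

lemma AE_in_degree_count_increment:
  assumes "k \<ge> 1"
  shows "AE \<omega> in M. \<bar>real (in_degree_count k (G (Suc s) \<omega>)) - real (in_degree_count k (G s \<omega>))\<bar> \<le> 1"
proof (cases "s mod (m + 1) = 0")
  case True
  show ?thesis
    using AE_pa_graphs[of s] AE_add_loop[OF True]
    by eventually_elim (simp add: in_degree_count_add_loop[OF _ True assms])
next
  case False
  show ?thesis
    using AE_pa_graphs[of s] AE_attach_arc[OF False allI[OF impI[OF AE_pa_graphs]]]
  proof eventually_elim
    case (elim \<omega>)
    from elim(2) obtain j where "j \<in> verts (G s \<omega>)" "G (Suc s) \<omega> = attach_arc m s (G s \<omega>) j" by blast
    then show ?case using abs_in_degree_count_attach_arc[OF elim(1) False _ assms] by simp
  qed
qed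

text \<open>Here the count is compared with the exact linear function of slope \<open>p\<close> per
  time step. It differs from the centring sequence by a bounded amount, so linear growth of the
  second moments survives, and dividing by \<open>t\<close> gives the limit \<open>p\<close>. Along
  \<open>t = n * (m + 1)\<close> the slope per vertex is
  \<open>p * (m + 1) = pa_limit m k\<close>.\<close>

lemma AE_in_degree_count_limit:
  assumes m: "m \<ge> 1" and k: "k \<ge> 1"
  shows "AE \<omega> in M. (\<lambda>n. real (in_degree_count k (G (n * (m + 1)) \<omega>)) / real n) \<longlonglongrightarrow> pa_limit m k"
proof -
  define p where "p = pa_limit m k / real (m + 1)"
  define Y where "Y t \<omega> = real (in_degree_count k (G t \<omega>)) - p * real t" for t \<omega>
  obtain B where B: "B \<ge> 0" "\<And>t. \<bar>pa_centre m k t - pa_limit m k * real t / real (m + 1)\<bar> \<le> B"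
    using pa_centre_linear[of m k] by blast
  obtain C where C: "C \<ge> 0"
      "\<And>t. expectation (\<lambda>\<omega>. (real (in_degree_count k (G t \<omega>)) - pa_centre m k t)\<^sup>2) \<le> C * real t"
    using second_moment_linear[OF m k] by blast
  have "AE \<omega> in M. (\<lambda>t. Y t \<omega> / real t) \<longlonglongrightarrow> 0"
  proof (rule AE_tendsto_zero_if_second_moment_linear)
    show "random_variable borel (Y t)" for t
      unfolding Y_def by (rule measurable_graph[of "\<lambda>g. real (in_degree_count k g) - p * real t" t])
    show Y_int: "integrable M (\<lambda>\<omega>. (Y t \<omega>)\<^sup>2)" for t
      unfolding Y_def by (rule integrable_graph[of "\<lambda>g. (real (in_degree_count k g) - p * real t)\<^sup>2" t])
    show "expectation (\<lambda>\<omega>. (Y t \<omega>)\<^sup>2) \<le> (2 * C + 2 * B\<^sup>2) * (real t + 1)" for t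
    proof -
      let ?D = "\<lambda>\<omega>. real (in_degree_count k (G t \<omega>)) - pa_centre m k t"
      have int: "integrable M (\<lambda>\<omega>. (?D \<omega>)\<^sup>2)"
        by (rule integrable_graph[of "\<lambda>g. (real (in_degree_count k g) - pa_centre m k t)\<^sup>2" t])
      have "expectation (\<lambda>\<omega>. (Y t \<omega>)\<^sup>2) \<le> expectation (\<lambda>\<omega>. 2 * (?D \<omega>)\<^sup>2 + 2 * B\<^sup>2)"
      proof (rule integral_mono)
        show "integrable M (\<lambda>\<omega>. (Y t \<omega>)\<^sup>2)" by (rule Y_int)
        show "integrable M (\<lambda>\<omega>. 2 * (?D \<omega>)\<^sup>2 + 2 * B\<^sup>2)" using int by simp
        fix \<omega>
        define e where "e = pa_centre m k t - p * real t"
        have "\<bar>e\<bar> \<le> B" using B(2)[of t] by (simp add: e_def p_def)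
        then have "e\<^sup>2 \<le> B\<^sup>2" using B(1) by (intro abs_le_square_iff[THEN iffD1]) simp
        moreover have Y: "Y t \<omega> = ?D \<omega> + e" by (simp add: Y_def e_def)
        moreover have "(?D \<omega> + e)\<^sup>2 \<le> 2 * (?D \<omega>)\<^sup>2 + 2 * e\<^sup>2"
          using sum_squares_bound[of "?D \<omega>" e] by (simp only: power2_sum)
        ultimately show "(Y t \<omega>)\<^sup>2 \<le> 2 * (?D \<omega>)\<^sup>2 + 2 * B\<^sup>2" unfolding Y by linarith
      qed
      also have "\<dots> = 2 * expectation (\<lambda>\<omega>. (?D \<omega>)\<^sup>2) + 2 * B\<^sup>2"
        using int prob_space by simp
      also have "\<dots> \<le> 2 * (C * real t) + 2 * B\<^sup>2" using C(2)[of t] by simp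
      also have "\<dots> \<le> (2 * C + 2 * B\<^sup>2) * (real t + 1)"
        using C(1) by (simp add: algebra_simps)
      finally show ?thesis .
    qed
    \<comment> \<open>One null set for each time; there are countably many.\<close>
    have "AE \<omega> in M. \<forall>t. \<bar>real (in_degree_count k (G (Suc t) \<omega>)) - real (in_degree_count k (G t \<omega>))\<bar> \<le> 1"
      unfolding AE_all_countable using AE_in_degree_count_increment[OF k] by blast
    then show "AE \<omega> in M. \<forall>t. \<bar>Y (Suc t) \<omega> - Y t \<omega>\<bar> \<le> 1 + \<bar>p\<bar>"
    proof eventually_elim
      case (elim \<omega>)
      show ?case
      proof
        fix t
        have "Y (Suc t) \<omega> - Y t \<omega>
            = real (in_degree_count k (G (Suc t) \<omega>)) - real (in_degree_count k (G t \<omega>)) - p"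
          by (simp add: Y_def algebra_simps)
        then show "\<bar>Y (Suc t) \<omega> - Y t \<omega>\<bar> \<le> 1 + \<bar>p\<bar>" using elim[THEN spec, of t] by linarith
      qed
    qed
  qed
  then show ?thesis
  proof eventually_elim
    case (elim \<omega>)
    have "filterlim (\<lambda>n. n * (m + 1)) at_top sequentially"
      by (intro filterlim_subseq strict_monoI mult_strict_right_mono) simp_all
    from filterlim_compose[OF elim this]
    have lim: "(\<lambda>n. Y (n * (m + 1)) \<omega> / real (n * (m + 1)) * real (m + 1) + pa_limit m k)
        \<longlonglongrightarrow> 0 * real (m + 1) + pa_limit m k"
      by (intro tendsto_intros)
    have nz: "real (m + 1) \<noteq> 0" by simp
    \<comment> \<open>The identity is a cancellation that needs \<open>n > 0\<close>, hence holds
      only eventually.\<close>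
    have "\<forall>\<^sub>F n in sequentially. Y (n * (m + 1)) \<omega> / real (n * (m + 1)) * real (m + 1) + pa_limit m k
        = real (in_degree_count k (G (n * (m + 1)) \<omega>)) / real n"
      using eventually_gt_at_top[of 0]
    proof eventually_elim
      case (elim n)
      have cancel: "(a - b / c * (x * c)) / (x * c) * c + b = a / x"
        if "x \<noteq> 0" "c \<noteq> 0" for a b c x :: real
        using that by (simp add: field_simps)
      show ?case
        unfolding Y_def p_def of_nat_mult using elim by (intro cancel nz) simp
    qed
    from Lim_transform_eventually[OF lim this] show ?case by simp
  qed
qed

end

theorem theorem4p2:
  fixes M :: "'a measure" and m k :: nat and G :: "nat \<Rightarrow> 'a \<Rightarrow> multidigraph"
  assumes "m \<ge> 1"
    and "II_PA M m G"
    and "k \<ge> 1"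
  shows "AE \<omega> in M. (\<lambda>n. real (in_degree_count k (G (n * (m + 1)) \<omega>)) / real n)
    \<longlonglongrightarrow> (1 + 1 / real m) * Gamma (real k) * Gamma (2 + 1 / real m)
      / Gamma (real k + 2 + 1 / real m)"
  using II_PA.AE_in_degree_count_limit[OF assms(2,1,3)] unfolding pa_limit_def .

end
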